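(* Let $D=(F,R,>)$ be a defeasible theory, let $\mathcal{M}$ be the logic program associated with $D$ (described in the context), and let $p$ be a literal. (a) If $D\vdash +\partial p$, then the atom $\mathtt{defeasibly}(p)$ belongs to every stable model of $\mathcal{M}$. (b) If $D\vdash -\partial p$, then $\mathtt{defeasibly}(p)$ belongs to no stable model of $\mathcal{M}$. (c) If $D$ is decisive, then the converses of (a) and (b) also hold: if $\mathtt{defeasibly}(p)$ belongs to every stable model of $\mathcal{M}$ then $D\vdash+\partial p$, and if $\mathtt{defeasibly}(p)$ belongs to no stable model of $\mathcal{M}$ then $D\vdash-\partial p$.
   Context: Literals are atoms $p$ or negated atoms $\neg p$; for a literal $q$, $\sim q$ is its complement. A defeasible theory $D=(F,R,>)$ consists of a finite set $F$ of literals (facts), a finite set $R$ of propositional rules, and a binary relation $>$ on $R$ whose transitive closure is irreflexive. Each rule $r$ has a unique label, an antecedent $A(r)$ (finite set of literals), a head $C(r)$ (a literal) and a kind: strict ($\to$), defeasible ($\Rightarrow$) or defeater ($\leadsto$). $R_s$: strict rules; $R_{sd}$: strict or defeasible rules; $R[q]$, $R_s[q]$, $R_{sd}[q]$: those with head $q$. A derivation in $D$ is a finite sequence $P(1),\dots,P(n)$ of tagged literals $+\Delta q,-\Delta q,+\partial q,-\partial q$ such that for each $i$ (with $P(1..i)$ the initial segment of length $i$): ($+\Delta$) if $P(i+1)=+\Delta q$ then $q\in F$ or $\exists r\in R_s[q]\,\forall a\in A(r):+\Delta a\in P(1..i)$; ($-\Delta$) if $P(i+1)=-\Delta q$ then $q\notin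 F$ and $\forall r\in R_s[q]\,\exists a\in A(r): -\Delta a\in P(1..i)$; ($+\partial$) if $P(i+1)=+\partial q$ then either $+\Delta q\in P(1..i)$, or: $\exists r\in R_{sd}[q]\,\forall a\in A(r):+\partial a\in P(1..i)$, and $-\Delta\sim q\in P(1..i)$, and for every $s\in R[\sim q]$ either $\exists a\in A(s):-\partial a\in P(1..i)$ or $\exists t\in R_{sd}[q]$ with $t>s$ and $\forall a\in A(t):+\partial a\in P(1..i)$; ($-\partial$) if $P(i+1)=-\partial q$ then $-\Delta q\in P(1..i)$ and either $\forall r\in R_{sd}[q]\,\exists a\in A(r):-\partial a\in P(1..i)$, or $+\Delta\sim q\in P(1..i)$, or $\exists s\in R[\sim q]$ with $\forall a\in A(s):+\partial a\in P(1..i)$ and for every $t\in R_{sd}[q]$ either $\exists a\in A(t):-\partial a\in P(1..i)$ or $t\not> s$. $D\vdash L$ means $L$ occurs in some derivation in $D$. The dependency graph of $D$ has vertices $\{q,\sim q\}$ for literals $q$ of $D$ and an arc from $\{b,\sim b\}$ to $\{a,\sim a\}$ whenever some $r\in R[b]$ has $a\in A(r)$. $D$ is decisive iff this graph is acyclic. The program $\mathcal{M}$ consists of all ground instances (label variables $R,S,T$ over rule labels, $X,Y_i,U_i,V_i$ over literals, $B$ over lists of literals, all $n\ge0$; $\sim$ is the complement on literals) of $\mathtt{supportive\_rule}(R,X,B)\leftarrow\mathtt{strict}(R,X,B)$; $\mathtt{supportive\_rule}(R,X,B)\leftarrow\mathtt{defeasible}(R,X,B)$; $\mathtt{rule}(R,X,B)\leftarrow\mathtt{supportive\_rule}(R,X,B)$;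 $\mathtt{rule}(R,X,B)\leftarrow\mathtt{defeater}(R,X,B)$; $\mathtt{definitely}(X)\leftarrow\mathtt{fact}(X)$; $\mathtt{definitely}(X)\leftarrow\mathtt{strict}(R,X,[Y_1,\dots,Y_n]),\mathtt{definitely}(Y_1),\dots,\mathtt{definitely}(Y_n)$; $\mathtt{defeasibly}(X)\leftarrow\mathtt{definitely}(X)$; $\mathtt{defeasibly}(X)\leftarrow \mathit{not}\ \mathtt{definitely}(\sim X),\mathtt{supportive\_rule}(R,X,[Y_1,\dots,Y_n]),\mathtt{defeasibly}(Y_1),\dots,\mathtt{defeasibly}(Y_n),\mathit{not}\ \mathtt{overruled}(R,X)$; $\mathtt{overruled}(R,X)\leftarrow\mathtt{rule}(S,\sim X,[U_1,\dots,U_n]),\mathtt{defeasibly}(U_1),\dots,\mathtt{defeasibly}(U_n),\mathit{not}\ \mathtt{defeated}(S,\sim X)$; $\mathtt{defeated}(S,\sim X)\leftarrow\mathtt{sup}(T,S),\mathtt{supportive\_rule}(T,X,[V_1,\dots,V_n]),\mathtt{defeasibly}(V_1),\dots,\mathtt{defeasibly}(V_n)$; plus the facts $\mathtt{fact}(p)$ for $p\in F$; $\mathtt{strict}(r,p,[q_1,\dots,q_n])$, $\mathtt{defeasible}(r,p,[q_1,\dots,q_n])$, $\mathtt{defeater}(r,p,[q_1,\dots,q_n])$ for each strict, defeasible, resp. defeater rule $r$ of $R$ with antecedent $\{q_1,\dots,q_n\}$ and head $p$; and $\mathtt{sup}(r_i,r_j)$ whenever $r_i>r_j$. A set $M$ of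 ground atoms is a stable model of $\mathcal{M}$ iff $M$ is the least Herbrand model of the reduct $\mathcal{M}^M$, obtained by deleting every ground clause containing $\mathit{not}\ C$ with $C\in M$ and then deleting all $\mathit{not}$-literals from the remaining clauses. *)

theory Defs
  imports Main
begin

datatype 'a literal = Pos 'a | Neg 'a

fun compl :: "'a literal \<Rightarrow> 'a literal" where
  "compl (Pos a) = Neg a"
| "compl (Neg a) = Pos a"

datatype rule_kind = Strict | Defeasible | Defeater

record ('l, 'a) drule =
  label :: 'l
  ante :: "'a literal set"
  concl :: "'a literal"
  kind :: rule_kind

record ('l, 'a) dtheory =
  facts :: "'a literal set"
  rules :: "('l, 'a) drule set"
  superior :: "(('l, 'a) drule \<times> ('l, 'a) drule) set"
    \<comment> \<open>\<open>(t, s) \<in> superior D\<close> means \<open>t > s\<close>\<close>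

definition defeasible_theory :: "('l, 'a) dtheory \<Rightarrow> bool" where
  "defeasible_theory D \<longleftrightarrow>
     finite (facts D) \<and> finite (rules D) \<and>
     (\<forall>r\<in>rules D. finite (ante r)) \<and>
     inj_on label (rules D) \<and>
     superior D \<subseteq> rules D \<times> rules D \<and>
     irrefl ((superior D)\<^sup>+)"

definition rules_for :: "('l, 'a) dtheory \<Rightarrow> 'a literal \<Rightarrow> ('l, 'a) drule set" where
  "rules_for D q = {r \<in> rules D. concl r = q}"

definition strict_for :: "('l, 'a) dtheory \<Rightarrow> 'a literal \<Rightarrow> ('l, 'a) drule set" where
  "strict_for D q = {r \<in> rules_for D q. kind r = Strict}"

definition supportive_for :: "('l, 'a) dtheory \<Rightarrow> 'a literal \<Rightarrow> ('l, 'a) drule set" where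
  "supportive_for D q = {r \<in> rules_for D q. kind r = Strict \<or> kind r = Defeasible}"


section \<open>Derivations\<close>

datatype 'a tagged =
    PlusDelta "'a literal"
  | MinusDelta "'a literal"
  | PlusPartial "'a literal"
  | MinusPartial "'a literal"

text \<open>\<open>step_ok D S L\<close>: the tagged literal \<open>L\<close> may be appended to a derivation whose
  set of entries is \<open>S\<close>.\<close>

fun step_ok :: "('l, 'a) dtheory \<Rightarrow> 'a tagged set \<Rightarrow> 'a tagged \<Rightarrow> bool" where
  "step_ok D S (PlusDelta q) \<longleftrightarrow>
     q \<in> facts D \<or> (\<exists>r\<in>strict_for D q. \<forall>a\<in>ante r. PlusDelta a \<in> S)"
| "step_ok D S (MinusDelta q) \<longleftrightarrow>
     q \<notin> facts D \<and> (\<forall>r\<in>strict_for D q. \<exists>a\<in>ante r. MinusDelta a \<in> S)"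
| "step_ok D S (PlusPartial q) \<longleftrightarrow>
     PlusDelta q \<in> S \<or>
     ((\<exists>r\<in>supportive_for D q. \<forall>a\<in>ante r. PlusPartial a \<in> S) \<and>
      MinusDelta (compl q) \<in> S \<and>
      (\<forall>s\<in>rules_for D (compl q).
         (\<exists>a\<in>ante s. MinusPartial a \<in> S) \<or>
         (\<exists>t\<in>supportive_for D q. (t, s) \<in> superior D \<and> (\<forall>a\<in>ante t. PlusPartial a \<in> S))))"
| "step_ok D S (MinusPartial q) \<longleftrightarrow>
     MinusDelta q \<in> S \<and>
     ((\<forall>r\<in>supportive_for D q. \<exists>a\<in>ante r. MinusPartial a \<in> S) \<or>
      PlusDelta (compl q) \<in> S \<or>
      (\<exists>s\<in>rules_for D (compl q).
         (\<forall>a\<in>ante s. PlusPartial a \<in> S) \<and>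
         (\<forall>t\<in>supportive_for D q. (\<exists>a\<in>ante t. MinusPartial a \<in> S) \<or> (t, s) \<notin> superior D)))"

definition derivation :: "('l, 'a) dtheory \<Rightarrow> 'a tagged list \<Rightarrow> bool" where
  "derivation D P \<longleftrightarrow> (\<forall>i < length P. step_ok D (set (take i P)) (P ! i))"

definition derivable :: "('l, 'a) dtheory \<Rightarrow> 'a tagged \<Rightarrow> bool" where
  "derivable D L \<longleftrightarrow> (\<exists>P. derivation D P \<and> L \<in> set P)"


section \<open>Decisiveness\<close>

text \<open>Every end point of an arc is a vertex of the dependency graph and the remaining vertices
  are isolated, so the arcs alone determine whether the graph is acyclic.\<close>

definition dependency_arcs :: "('l, 'a) dtheory \<Rightarrow> ('a literal set \<times> 'a literal set) set" where
  "dependency_arcs D =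
     {({b, compl b}, {a, compl a}) | a b. \<exists>r\<in>rules_for D b. a \<in> ante r}"

definition decisive :: "('l, 'a) dtheory \<Rightarrow> bool" where
  "decisive D \<longleftrightarrow> acyclic (dependency_arcs D)"


section \<open>Ground normal logic programs and stable models\<close>

datatype 'b clause = Clause (chead: 'b) (cpos: "'b list") (cneg: "'b list")

definition reduct :: "'b clause set \<Rightarrow> 'b set \<Rightarrow> 'b clause set" where
  "reduct Pr M = {Clause (chead c) (cpos c) [] | c. c \<in> Pr \<and> set (cneg c) \<inter> M = {}}"

text \<open>Negative literals are ignored: only used for programs without them, such as reducts.\<close>

definition herbrand_model :: "'b clause set \<Rightarrow> 'b set \<Rightarrow> bool" where
  "herbrand_model Pr M \<longleftrightarrow> (\<forall>c\<in>Pr. set (cpos c) \<subseteq> M \<longrightarrow> chead c \<in> M)"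

definition least_herbrand_model :: "'b clause set \<Rightarrow> 'b set \<Rightarrow> bool" where
  "least_herbrand_model Pr M \<longleftrightarrow>
     herbrand_model Pr M \<and> (\<forall>N. herbrand_model Pr N \<longrightarrow> M \<subseteq> N)"

definition stable_model :: "'b clause set \<Rightarrow> 'b set \<Rightarrow> bool" where
  "stable_model Pr M \<longleftrightarrow> least_herbrand_model (reduct Pr M) M"


section \<open>The logic program of a defeasible theory\<close>

datatype ('l, 'a) gatom =
    AFact "'a literal"
  | AStrict 'l "'a literal" "'a literal list"
  | ADefeasible 'l "'a literal" "'a literal list"
  | ADefeater 'l "'a literal" "'a literal list"
  | ASup 'l 'l
  | ASupportiveRule 'l "'a literal" "'a literal list"
  | ARule 'l "'a literal" "'a literal list"
  | ADefinitely "'a literal"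
  | ADefeasibly "'a literal"
  | AOverruled 'l "'a literal"
  | ADefeated 'l "'a literal"

text \<open>Antecedents are sets, but the atoms representing rules carry lists; \<open>enum\<close> fixes the list
  \<open>[q\<^sub>1, \<dots>, q\<^sub>n]\<close> in which the antecedent \<open>{q\<^sub>1, \<dots>, q\<^sub>n}\<close> of each rule is written down.\<close>

definition antecedent_enum ::
  "('l, 'a) dtheory \<Rightarrow> (('l, 'a) drule \<Rightarrow> 'a literal list) \<Rightarrow> bool" where
  "antecedent_enum D enum \<longleftrightarrow> (\<forall>r\<in>rules D. set (enum r) = ante r)"

text \<open>Label variables are instantiated by the labels of the rules of \<open>D\<close>, literal variables by
  arbitrary literals over the atom type.\<close>

inductive_set program ::
  "('l, 'a) dtheory \<Rightarrow> (('l, 'a) drule \<Rightarrow> 'a literal list) \<Rightarrow> ('l, 'a) gatom clause set"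
  for D :: "('l, 'a) dtheory" and enum :: "('l, 'a) drule \<Rightarrow> 'a literal list"
where
  supportive_strict: "R \<in> label ` rules D \<Longrightarrow>
    Clause (ASupportiveRule R X B) [AStrict R X B] [] \<in> program D enum"
| supportive_defeasible: "R \<in> label ` rules D \<Longrightarrow>
    Clause (ASupportiveRule R X B) [ADefeasible R X B] [] \<in> program D enum"
| rule_supportive: "R \<in> label ` rules D \<Longrightarrow>
    Clause (ARule R X B) [ASupportiveRule R X B] [] \<in> program D enum"
| rule_defeater: "R \<in> label ` rules D \<Longrightarrow>
    Clause (ARule R X B) [ADefeater R X B] [] \<in> program D enum"
| definitely_fact:
    "Clause (ADefinitely X) [AFact X] [] \<in> program D enum"
| definitely_strict: "R \<in> label ` rules D \<Longrightarrow>
    Clause (ADefinitely X) (AStrict R X Ys # map ADefinitely Ys) [] \<in> program D enum"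
| defeasibly_definitely:
    "Clause (ADefeasibly X) [ADefinitely X] [] \<in> program D enum"
| defeasibly_supportive: "R \<in> label ` rules D \<Longrightarrow>
    Clause (ADefeasibly X) (ASupportiveRule R X Ys # map ADefeasibly Ys)
      [ADefinitely (compl X), AOverruled R X] \<in> program D enum"
| overruled: "R \<in> label ` rules D \<Longrightarrow> S \<in> label ` rules D \<Longrightarrow>
    Clause (AOverruled R X) (ARule S (compl X) Us # map ADefeasibly Us)
      [ADefeated S (compl X)] \<in> program D enum"
| defeated: "S \<in> label ` rules D \<Longrightarrow> T \<in> label ` rules D \<Longrightarrow>
    Clause (ADefeated S (compl X))
      (ASup T S # ASupportiveRule T X Vs # map ADefeasibly Vs) [] \<in> program D enum"
| fact: "p \<in> facts D \<Longrightarrow>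
    Clause (AFact p) [] [] \<in> program D enum"
| strict: "r \<in> rules D \<Longrightarrow> kind r = Strict \<Longrightarrow>
    Clause (AStrict (label r) (concl r) (enum r)) [] [] \<in> program D enum"
| defeasible: "r \<in> rules D \<Longrightarrow> kind r = Defeasible \<Longrightarrow>
    Clause (ADefeasible (label r) (concl r) (enum r)) [] [] \<in> program D enum"
| defeater: "r \<in> rules D \<Longrightarrow> kind r = Defeater \<Longrightarrow>
    Clause (ADefeater (label r) (concl r) (enum r)) [] [] \<in> program D enum"
| sup: "(r, s) \<in> superior D \<Longrightarrow>
    Clause (ASup (label r) (label s)) [] [] \<in> program D enum"

end

theory Submission imports Defs begin

text \<open>
  Soundness, (a) and (b), is an induction along derivations: a stable model is closed under the
  clauses and every atom in it is supported by a clause, and these two properties match the four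
  inference conditions. For (c), acyclicity of the dependency graph gives, by well-founded
  induction, that every literal has a derivable positive or negative tag. The set of provable
  conclusions is then itself a stable model: decidedness makes it a model of its reduct, coherence
  of derivations makes it minimal. As \<open>p\<close> is decided and a stable model exists, soundness for
  the opposite tag rules out the wrong alternative in both converses.
\<close>

section \<open>Derivations\<close>

lemma compl_compl [simp]: "compl (compl q) = q"
  by (cases q) auto

lemma compl_eq_iff [simp]: "compl p = compl q \<longleftrightarrow> p = q"
  by (metis compl_compl)

text \<open>Each condition uses membership in \<open>S\<close> only positively: failure is expressed
  by minus tags, never by absence from \<open>S\<close>.\<close>

lemma step_ok_mono:
  assumes "step_ok D S L" "S \<subseteq> T"
  shows "step_ok D T L"
proof -
  \<comment> \<open>Object-level implications are used so that these facts chain with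
    \<open>conj_mono\<close> and \<open>disj_mono\<close>.\<close>
  have T: "K \<in> S \<longrightarrow> K \<in> T" for K using assms(2) by blast
  have quant: "(\<And>x. P x \<longrightarrow> Q x) \<Longrightarrow> (\<forall>x\<in>X. P x) \<longrightarrow> (\<forall>x\<in>X. Q x)"
    "(\<And>x. P x \<longrightarrow> Q x) \<Longrightarrow> (\<exists>x\<in>X. P x) \<longrightarrow> (\<exists>x\<in>X. Q x)" for P Q and X :: "'c set"
    by blast+
  have "step_ok D S L \<longrightarrow> step_ok D T L"
    by (cases L; simp only: step_ok.simps; intro conj_mono disj_mono quant T imp_refl)
  with assms(1) show ?thesis by blast
qed

lemma derivation_Nil [simp]: "derivation D []"
  by (simp add: derivation_def)

lemma derivation_snoc:
  "derivation D (P @ [L]) \<longleftrightarrow> derivation D P \<and> step_ok D (set P) L"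
  by (auto simp: derivation_def less_Suc_eq nth_append)

text \<open>By monotonicity: prepending \<open>P\<close> only enlarges the set against which each
  entry of \<open>Q\<close> is checked.\<close>

lemma derivation_append:
  "derivation D P \<Longrightarrow> derivation D Q \<Longrightarrow> derivation D (P @ Q)"
proof (induction Q rule: rev_induct)
  case (snoc L Q)
  then have "derivation D (P @ Q)" "step_ok D (set (P @ Q)) L"
    using step_ok_mono[of D "set Q" L "set (P @ Q)"] by (auto simp: derivation_snoc)
  then show ?case
    using derivation_snoc[of D "P @ Q" L] by simp
qed simp

lemma finite_derivable_set:
  assumes "finite S" "\<And>L. L \<in> S \<Longrightarrow> derivable D L"
  shows "\<exists>P. derivation D P \<and> S \<subseteq> set P"
  using assms
proof (induction S)
  case empty
  then show ?case using derivation_Nil by blast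
next
  case (insert L S)
  then obtain P Q where "derivation D P" "S \<subseteq> set P" "derivation D Q" "L \<in> set Q"
    unfolding derivable_def by blast
  then show ?case
    by (intro exI[of _ "P @ Q"]) (auto intro: derivation_append)
qed

text \<open>Presents derivability as a least closed set: \<open>Q\<close> stands in for the earlier
  entries, so inductions over derivable tags can avoid lists.\<close>

lemma derivable_induct:
  assumes step: "\<And>L. step_ok D {K. Q K} L \<Longrightarrow> Q L"
    and "derivable D L"
  shows "Q L"
proof -
  have "\<forall>K\<in>set P. Q K" if "derivation D P" for P
    using that
  proof (induction P rule: rev_induct)
    case (snoc K P)
    then have "step_ok D {K. Q K} K"
      using step_ok_mono[of D "set P" K "{K. Q K}"] by (auto simp: derivation_snoc)
    with snoc step show ?case by (auto simp: derivation_snoc)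
  qed simp
  with assms(2) show ?thesis unfolding derivable_def by blast
qed

text \<open>Forgets positions: what the initial segment before an entry licenses, the whole sequence
  licenses too.\<close>

lemma derivation_step:
  "derivation D P \<Longrightarrow> L \<in> set P \<Longrightarrow> step_ok D (set P) L"
proof (induction P rule: rev_induct)
  case (snoc K P)
  then have "step_ok D (set P) L" by (auto simp only: derivation_snoc set_append set_simps Un_iff singleton_iff)
  then show ?case by (rule step_ok_mono) auto
qed simp

lemma derivable_step_ok: "derivable D L \<Longrightarrow> step_ok D {K. derivable D K} L"
  unfolding derivable_def by (blast intro: step_ok_mono[OF derivation_step])

section \<open>Compactness: derivability is a fixed point of the inference conditions\<close>

lemma finite_antecedents:
  "defeasible_theory D \<Longrightarrow> finite (\<Union>r\<in>rules D. ante r)"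
  by (auto simp: defeasible_theory_def)

text \<open>A condition on \<open>q\<close> inspects only tags of \<open>q\<close>, of its
  complement and of antecedent literals, and these are finitely many.\<close>

lemma step_ok_finite:
  assumes D: "defeasible_theory D" and L: "step_ok D S L"
  shows "\<exists>T\<subseteq>S. finite T \<and> step_ok D T L"
proof -
  define A where "A q = insert q (insert (compl q) (\<Union>r\<in>rules D. ante r))" for q
  \<comment> \<open>\<open>T q\<close> keeps the tags in \<open>S\<close> whose literal lies in
    \<open>A q\<close>; the right \<open>q\<close> will be the literal carried by
    \<open>L\<close>.\<close>
  define T where
    "T q = S \<inter> (PlusDelta ` A q \<union> MinusDelta ` A q \<union> PlusPartial ` A q \<union> MinusPartial ` A q)" for q
  have "finite (T q)" for q
    using finite_antecedents[OF D] by (simp add: T_def A_def)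
  moreover have "T q \<subseteq> S" for q by (auto simp: T_def)
  moreover have "\<exists>q. step_ok D (T q) L"
  proof -
    have mem: "PlusDelta a \<in> T q \<longleftrightarrow> PlusDelta a \<in> S" "MinusDelta a \<in> T q \<longleftrightarrow> MinusDelta a \<in> S"
      "PlusPartial a \<in> T q \<longleftrightarrow> PlusPartial a \<in> S" "MinusPartial a \<in> T q \<longleftrightarrow> MinusPartial a \<in> S"
      if "a \<in> A q" for a q
      using that by (auto simp: T_def)
    have sub: "a \<in> A q" if "r \<in> rules D" "a \<in> ante r" for r a q
      using that by (auto simp: A_def)
    have ante: "(\<forall>a\<in>ante r. PlusDelta a \<in> T q) \<longleftrightarrow> (\<forall>a\<in>ante r. PlusDelta a \<in> S)"
      "(\<exists>a\<in>ante r. MinusDelta a \<in> T q) \<longleftrightarrow> (\<exists>a\<in>ante r. MinusDelta a \<in> S)"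
      "(\<forall>a\<in>ante r. PlusPartial a \<in> T q) \<longleftrightarrow> (\<forall>a\<in>ante r. PlusPartial a \<in> S)"
      "(\<exists>a\<in>ante r. MinusPartial a \<in> T q) \<longleftrightarrow> (\<exists>a\<in>ante r. MinusPartial a \<in> S)"
      if "r \<in> rules D" for r q
      using mem[OF sub[OF that]] by simp_all
    have self: "PlusDelta q \<in> T q \<longleftrightarrow> PlusDelta q \<in> S" "MinusDelta q \<in> T q \<longleftrightarrow> MinusDelta q \<in> S"
      "PlusDelta (compl q) \<in> T q \<longleftrightarrow> PlusDelta (compl q) \<in> S"
      "MinusDelta (compl q) \<in> T q \<longleftrightarrow> MinusDelta (compl q) \<in> S" for q
      by (auto simp: T_def A_def)
    have "step_ok D (T q) (PlusDelta q) \<longleftrightarrow> step_ok D S (PlusDelta q)"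
      "step_ok D (T q) (MinusDelta q) \<longleftrightarrow> step_ok D S (MinusDelta q)"
      "step_ok D (T q) (PlusPartial q) \<longleftrightarrow> step_ok D S (PlusPartial q)"
      "step_ok D (T q) (MinusPartial q) \<longleftrightarrow> step_ok D S (MinusPartial q)" for q
      unfolding step_ok.simps strict_for_def supportive_for_def rules_for_def
      by (simp_all add: ante self cong: conj_cong)
    then show ?thesis using L by (cases L) blast+
  qed
  ultimately show ?thesis by blast
qed

text \<open>A finite set of derivable tags already licenses \<open>L\<close>; concatenation packs
  this set into one derivation, to which \<open>L\<close> is appended.\<close>

lemma derivable_step:
  assumes D: "defeasible_theory D" and L: "step_ok D {K. derivable D K} L"
  shows "derivable D L"
proof -
  from step_ok_finite[OF D L] obtain T
    where T: "T \<subseteq> {K. derivable D K}" "finite T" "step_ok D T L" by blast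
  then obtain P where "derivation D P" "T \<subseteq> set P"
    using finite_derivable_set[of T D] by blast
  with T have "derivation D (P @ [L])"
    using step_ok_mono[of D T L "set P"] by (simp add: derivation_snoc)
  then show ?thesis unfolding derivable_def by force
qed

lemma derivable_iff_step_ok:
  "defeasible_theory D \<Longrightarrow> derivable D L \<longleftrightarrow> step_ok D {K. derivable D K} L"
  using derivable_step derivable_step_ok by blast

section \<open>Coherence: opposite tags of a literal are never both derivable\<close>

definition coherent :: "'a tagged set \<Rightarrow> bool" where
  "coherent S \<longleftrightarrow> (\<forall>q. \<not> (PlusDelta q \<in> S \<and> MinusDelta q \<in> S) \<and>
                        \<not> (PlusPartial q \<in> S \<and> MinusPartial q \<in> S))"

lemma coherent_step_Delta:
  "coherent S \<Longrightarrow> step_ok D S (PlusDelta q) \<Longrightarrow> step_ok D S (MinusDelta q) \<Longrightarrow> False"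
  unfolding coherent_def step_ok.simps by blast

text \<open>The minus condition is the strong negation of the plus condition: connectives and
  quantifiers are dualised and tags replaced by their opposites, so satisfying both would need an
  opposite pair in \<open>S\<close>.\<close>

lemma coherent_step_Partial:
  "coherent S \<Longrightarrow> step_ok D S (PlusPartial q) \<Longrightarrow> step_ok D S (MinusPartial q) \<Longrightarrow> False"
  unfolding coherent_def step_ok.simps by meson

lemma coherent_derivation: "derivation D P \<Longrightarrow> coherent (set P)"
proof (induction P rule: rev_induct)
  case Nil
  then show ?case by (simp add: coherent_def)
next
  case (snoc L P)
  then have P: "derivation D P" "coherent (set P)" and L: "step_ok D (set P) L"
    by (auto simp: derivation_snoc)
  \<comment> \<open>Old and new entries alike are checked against the shorter, already coherent
    \<open>P\<close>, where opposite tags cannot both pass.\<close>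
  have step: "K \<in> set (P @ [L]) \<Longrightarrow> step_ok D (set P) K" for K
    using L derivation_step[OF P(1)] by auto
  show ?case
    unfolding coherent_def
    using coherent_step_Delta[OF P(2) step step] coherent_step_Partial[OF P(2) step step] by blast
qed

lemma derivable_coherent: "coherent {K. derivable D K}"
proof -
  \<comment> \<open>\<open>clash\<close> covers both kinds of opposite pair; such a pair would meet
    in the concatenation of its two derivations.\<close>
  have "\<not> (derivable D K \<and> derivable D L)"
    if clash: "\<And>S. coherent S \<Longrightarrow> K \<in> S \<Longrightarrow> L \<notin> S" for K L
  proof
    assume "derivable D K \<and> derivable D L"
    then obtain P Q where "derivation D P" "derivation D Q" "K \<in> set P" "L \<in> set Q"
      unfolding derivable_def by blast
    then show False
      using clash[OF coherent_derivation[OF derivation_append, of D P Q]] by auto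
  qed
  note c = this
  show ?thesis
    unfolding coherent_def mem_Collect_eq
    by (intro allI conjI c) (auto simp: coherent_def)
qed

section \<open>Decisive theories decide every literal\<close>

lemma finite_dependency_arcs:
  assumes "defeasible_theory D"
  shows "finite (dependency_arcs D)"
proof (rule finite_subset)
  show "dependency_arcs D \<subseteq>
      (\<Union>r\<in>rules D. \<Union>a\<in>ante r. {({concl r, compl (concl r)}, {a, compl a})})"
    unfolding dependency_arcs_def rules_for_def by auto
  show "finite (\<Union>r\<in>rules D. \<Union>a\<in>ante r. {({concl r, compl (concl r)}, {a, compl a})})"
    using assms by (auto simp: defeasible_theory_def)
qed

definition decided :: "('l, 'a) dtheory \<Rightarrow> 'a literal \<Rightarrow> bool" where
  "decided D q \<longleftrightarrow> (derivable D (PlusDelta q) \<or> derivable D (MinusDelta q)) \<and>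
                     (derivable D (PlusPartial q) \<or> derivable D (MinusPartial q))"

text \<open>Rules for \<open>compl q\<close> are included because the conditions on \<open>q\<close>
  also inspect its attackers; this matches the vertices \<open>{q, compl q}\<close> of the
  dependency graph.\<close>

lemma decided_step:
  assumes D: "defeasible_theory D"
    and dec: "\<And>r a. r \<in> rules_for D q \<union> rules_for D (compl q) \<Longrightarrow> a \<in> ante r \<Longrightarrow> decided D a"
  shows "decided D q"
proof -
  note iff = derivable_iff_step_ok[OF D]
  have sub: "strict_for D q \<subseteq> rules_for D q" "supportive_for D q \<subseteq> rules_for D q" for q
    by (auto simp: strict_for_def supportive_for_def)
  have Delta: "derivable D (PlusDelta x) \<or> derivable D (MinusDelta x)" if "x = q \<or> x = compl q" for x
  proof -
    have "decided D a" if "r \<in> strict_for D x" "a \<in> ante r" for r a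
      using that \<open>x = q \<or> x = compl q\<close> dec sub by blast
    then show ?thesis
      unfolding iff[of "PlusDelta x"] iff[of "MinusDelta x"] by (simp add: decided_def) blast
  qed
  moreover have "derivable D (PlusPartial q) \<or> derivable D (MinusPartial q)"
  proof (rule ccontr)
    assume "\<not> ?thesis"
    then have np: "\<not> step_ok D {K. derivable D K} (PlusPartial q)"
      and nm: "\<not> step_ok D {K. derivable D K} (MinusPartial q)"
      using derivable_step[OF D] by blast+
    \<comment> \<open>A derivable \<open>PlusDelta q\<close> would give
      \<open>PlusPartial q\<close>, and a derivable \<open>PlusDelta (compl q)\<close> would give
      \<open>MinusPartial q\<close>.\<close>
    have q: "derivable D (MinusDelta q)" and cq: "derivable D (MinusDelta (compl q))"
      using np nm Delta[of q] Delta[of "compl q"] by auto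
    have part: "derivable D (PlusPartial a) \<or> derivable D (MinusPartial a)"
      if "r \<in> rules_for D q \<union> rules_for D (compl q)" "a \<in> ante r" for r a
      using dec[OF that] by (simp add: decided_def)
    obtain r where "r \<in> supportive_for D q" "\<forall>a\<in>ante r. \<not> derivable D (MinusPartial a)"
      using nm q by auto
    then have r: "\<exists>r\<in>supportive_for D q. \<forall>a\<in>ante r. derivable D (PlusPartial a)"
      using part sub by blast
    \<comment> \<open>\<open>PlusPartial q\<close> can now fail only through an unbeaten attacker
      \<open>s\<close>, which turns out to witness the third alternative for
      \<open>MinusPartial q\<close>.\<close>
    obtain s where s: "s \<in> rules_for D (compl q)" "\<forall>a\<in>ante s. \<not> derivable D (MinusPartial a)"
      and t: "\<forall>t\<in>supportive_for D q. (t, s) \<in> superior D \<longrightarrow>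
                (\<exists>a\<in>ante t. \<not> derivable D (PlusPartial a))"
      using np r cq by auto
    have "\<forall>a\<in>ante s. derivable D (PlusPartial a)" using s part by blast
    moreover have "(\<exists>a\<in>ante t. derivable D (MinusPartial a)) \<or> (t, s) \<notin> superior D"
      if "t \<in> supportive_for D q" for t
      using t part sub that by blast
    ultimately show False
      using nm q s(1) unfolding step_ok.simps mem_Collect_eq by blast
  qed
  ultimately show ?thesis by (simp add: decided_def)
qed

text \<open>A finite acyclic relation has a well-founded converse, and arcs lead from heads to
  antecedents.\<close>

lemma decisive_decided:
  assumes D: "defeasible_theory D" and dec: "decisive D"
  shows "decided D q"
proof -
  have "wf ((dependency_arcs D)\<inverse>)"
    using dec finite_dependency_arcs[OF D] unfolding decisive_def
    by (rule finite_acyclic_wf_converse[rotated])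
  then have "\<forall>q. v = {q, compl q} \<longrightarrow> decided D q" for v
  proof (induction v rule: wf_induct_rule)
    case (less v)
    show ?case
    proof (intro allI impI)
      fix q assume v: "v = {q, compl q}"
      show "decided D q"
      proof (rule decided_step[OF D])
        fix r a assume r: "r \<in> rules_for D q \<union> rules_for D (compl q)" "a \<in> ante r"
        \<comment> \<open>Presenting the same vertex from \<open>compl q\<close> makes rules for
          \<open>compl q\<close> yield arcs leaving \<open>v\<close> as well.\<close>
        moreover have "v = {compl q, compl (compl q)}" using v by auto
        ultimately have "(v, {a, compl a}) \<in> dependency_arcs D"
          using v unfolding dependency_arcs_def by blast
        then show "decided D a" using less.IH by blast
      qed
    qed
  qed
  then show ?thesis by blast
qed

section \<open>Stable models\<close>

text \<open>Deleting an atom that no clause supports leaves a model, against minimality.\<close>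

lemma least_herbrand_model_supported:
  assumes M: "least_herbrand_model Pr M" and h: "h \<in> M"
  shows "\<exists>c\<in>Pr. chead c = h \<and> set (cpos c) \<subseteq> M"
proof (rule ccontr)
  assume unsupported: "\<not> ?thesis"
  have "herbrand_model Pr (M - {h})"
    unfolding herbrand_model_def
  proof (intro ballI impI)
    fix c assume c: "c \<in> Pr" "set (cpos c) \<subseteq> M - {h}"
    then have "set (cpos c) \<subseteq> M" by blast
    with c(1) M unsupported show "chead c \<in> M - {h}"
      by (auto simp: least_herbrand_model_def herbrand_model_def)
  qed
  then have "M \<subseteq> M - {h}" using M by (simp add: least_herbrand_model_def)
  with h show False by blast
qed

lemma herbrand_model_reduct:
  "herbrand_model (reduct Pr M) N \<longleftrightarrow>
     (\<forall>c\<in>Pr. set (cneg c) \<inter> M = {} \<longrightarrow> set (cpos c) \<subseteq> N \<longrightarrow> chead c \<in> N)"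
proof -
  have "reduct Pr M =
      (\<lambda>c. Clause (chead c) (cpos c) []) ` {c \<in> Pr. set (cneg c) \<inter> M = {}}"
    by (auto simp: reduct_def)
  then show ?thesis by (auto simp: herbrand_model_def)
qed

text \<open>A stable model satisfies the Clark completion. Soundness uses stability only in this
  form.\<close>

lemma stable_model_iff:
  assumes "stable_model Pr M"
  shows "h \<in> M \<longleftrightarrow> (\<exists>c\<in>Pr. chead c = h \<and> set (cpos c) \<subseteq> M \<and> set (cneg c) \<inter> M = {})"
proof
  have M: "least_herbrand_model (reduct Pr M) M"
    using assms by (simp add: stable_model_def)
  show "\<exists>c\<in>Pr. chead c = h \<and> set (cpos c) \<subseteq> M \<and> set (cneg c) \<inter> M = {}" if "h \<in> M"
    using least_herbrand_model_supported[OF M that] by (auto simp: reduct_def)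
  show "h \<in> M" if "\<exists>c\<in>Pr. chead c = h \<and> set (cpos c) \<subseteq> M \<and> set (cneg c) \<inter> M = {}"
    using M that unfolding least_herbrand_model_def herbrand_model_reduct by blast
qed

section \<open>Completion equivalences for the atoms of a stable model\<close>

inductive_cases program_headE:
  "Clause (AFact q) ps ns \<in> program D enum"
  "Clause (AStrict R X B) ps ns \<in> program D enum"
  "Clause (ADefeasible R X B) ps ns \<in> program D enum"
  "Clause (ADefeater R X B) ps ns \<in> program D enum"
  "Clause (ASup T S) ps ns \<in> program D enum"
  "Clause (ASupportiveRule R X B) ps ns \<in> program D enum"
  "Clause (ARule R X B) ps ns \<in> program D enum"
  "Clause (ADefinitely X) ps ns \<in> program D enum"
  "Clause (ADefeasibly X) ps ns \<in> program D enum"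
  "Clause (AOverruled R X) ps ns \<in> program D enum"
  "Clause (ADefeated S Y) ps ns \<in> program D enum"

locale theory_program =
  fixes D :: "('l, 'a) dtheory" and enum :: "('l, 'a) drule \<Rightarrow> 'a literal list"
  assumes D: "defeasible_theory D" and enum: "antecedent_enum D enum"
begin

abbreviation "Pr \<equiv> program D enum"

lemma set_enum: "r \<in> rules D \<Longrightarrow> set (enum r) = ante r"
  using enum by (simp add: antecedent_enum_def)

text \<open>Program atoms record only labels; unique labels recover the rule.\<close>

lemma label_eq: "r \<in> rules D \<Longrightarrow> s \<in> rules D \<Longrightarrow> label r = label s \<longleftrightarrow> r = s"
  using D by (auto simp: defeasible_theory_def dest: inj_onD)

lemma superior_rules: "(t, s) \<in> superior D \<Longrightarrow> t \<in> rules D \<and> s \<in> rules D"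
  using D by (auto simp: defeasible_theory_def)

lemma rules_forD: "r \<in> rules_for D q \<Longrightarrow> r \<in> rules D"
    "r \<in> strict_for D q \<Longrightarrow> r \<in> rules D" "r \<in> supportive_for D q \<Longrightarrow> r \<in> rules D"
  by (auto simp: rules_for_def strict_for_def supportive_for_def)

end

locale theory_stable_model = theory_program D enum
  for D :: "('l, 'a) dtheory" and enum +
  fixes M :: "('l, 'a) gatom set"
  assumes stable: "stable_model (program D enum) M"
begin

lemma in_M_cases:
  assumes "h \<in> M"
  obtains ps ns where "Clause h ps ns \<in> Pr" "set ps \<subseteq> M" "set ns \<inter> M = {}"
  using assms stable_model_iff[OF stable, of h] clause.collapse by metis

lemma in_M_intro: "Clause h ps ns \<in> Pr \<Longrightarrow> set ps \<subseteq> M \<Longrightarrow> set ns \<inter> M = {} \<Longrightarrow> h \<in> M"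
  using stable_model_iff[OF stable, of h] by (metis clause.sel)

lemma AFact_iff: "AFact q \<in> M \<longleftrightarrow> q \<in> facts D"
  by (auto elim!: in_M_cases program_headE intro: in_M_intro program.intros)

lemma AStrict_iff:
  "AStrict R X B \<in> M \<longleftrightarrow> (\<exists>r\<in>strict_for D X. R = label r \<and> B = enum r)"
  by (auto simp: strict_for_def rules_for_def
      elim!: in_M_cases program_headE intro: in_M_intro program.intros)

lemma ADefeasible_iff:
  "ADefeasible R X B \<in> M \<longleftrightarrow>
     (\<exists>r\<in>rules_for D X. kind r = Defeasible \<and> R = label r \<and> B = enum r)"
  by (auto simp: rules_for_def
      elim!: in_M_cases program_headE intro: in_M_intro program.intros)

lemma ADefeater_iff:
  "ADefeater R X B \<in> M \<longleftrightarrow>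
     (\<exists>r\<in>rules_for D X. kind r = Defeater \<and> R = label r \<and> B = enum r)"
  by (auto simp: rules_for_def
      elim!: in_M_cases program_headE intro: in_M_intro program.intros)

lemma ASup_iff:
  "ASup T S \<in> M \<longleftrightarrow> (\<exists>t s. (t, s) \<in> superior D \<and> T = label t \<and> S = label s)"
  by (auto elim!: in_M_cases program_headE intro: in_M_intro program.intros)

lemma ASupportiveRule_iff:
  "ASupportiveRule R X B \<in> M \<longleftrightarrow> (\<exists>r\<in>supportive_for D X. R = label r \<and> B = enum r)"
    (is "?l \<longleftrightarrow> ?r")
proof
  have "?l \<Longrightarrow> AStrict R X B \<in> M \<or> ADefeasible R X B \<in> M"
    by (auto elim!: in_M_cases[of "ASupportiveRule R X B"] program_headE)
  then show "?l \<Longrightarrow> ?r"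
    by (auto simp: AStrict_iff ADefeasible_iff strict_for_def supportive_for_def)
  assume ?r
  then have "R \<in> label ` rules D" "AStrict R X B \<in> M \<or> ADefeasible R X B \<in> M"
    unfolding AStrict_iff ADefeasible_iff
    by (auto simp: strict_for_def supportive_for_def rules_for_def)
  then show ?l
    using in_M_intro[OF supportive_strict] in_M_intro[OF supportive_defeasible] by auto
qed

lemma ARule_iff:
  "ARule R X B \<in> M \<longleftrightarrow> (\<exists>r\<in>rules_for D X. R = label r \<and> B = enum r)"
    (is "?l \<longleftrightarrow> ?r")
proof
  have "?l \<Longrightarrow> ASupportiveRule R X B \<in> M \<or> ADefeater R X B \<in> M"
    by (auto elim!: in_M_cases[of "ARule R X B"] program_headE)
  then show "?l \<Longrightarrow> ?r"
    by (auto simp: ASupportiveRule_iff ADefeater_iff supportive_for_def)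
  assume ?r
  then have "R \<in> label ` rules D" "ASupportiveRule R X B \<in> M \<or> ADefeater R X B \<in> M"
    unfolding ASupportiveRule_iff ADefeater_iff
    by (auto simp: supportive_for_def rules_for_def) (metis rule_kind.exhaust)
  then show ?l
    using in_M_intro[OF rule_supportive] in_M_intro[OF rule_defeater] by auto
qed

text \<open>The completion of \<open>definitely\<close> has the shape of the
  \<open>PlusDelta\<close> condition, with membership in \<open>M\<close> in place of earlier
  entries.\<close>

lemma ADefinitely_iff:
  "ADefinitely X \<in> M \<longleftrightarrow>
     X \<in> facts D \<or> (\<exists>r\<in>strict_for D X. \<forall>a\<in>ante r. ADefinitely a \<in> M)"
    (is "?l \<longleftrightarrow> ?r")
proof
  assume ?l
  then have "AFact X \<in> M \<or> (\<exists>R Ys. AStrict R X Ys \<in> M \<and> ADefinitely ` set Ys \<subseteq> M)"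
    by (auto elim!: in_M_cases[of "ADefinitely X"] program_headE)
  then show ?r
  proof
    assume "AFact X \<in> M"
    then show ?r by (simp add: AFact_iff)
  next
    assume "\<exists>R Ys. AStrict R X Ys \<in> M \<and> ADefinitely ` set Ys \<subseteq> M"
    then obtain r where r: "r \<in> strict_for D X" "ADefinitely ` set (enum r) \<subseteq> M"
      unfolding AStrict_iff by blast
    then show ?r using set_enum[OF rules_forD(2)[OF r(1)]] by (auto simp: image_subset_iff)
  qed
next
  assume ?r
  then show ?l
  proof
    assume "X \<in> facts D"
    then show ?l using in_M_intro[OF definitely_fact] by (simp add: AFact_iff)
  next
    assume "\<exists>r\<in>strict_for D X. \<forall>a\<in>ante r. ADefinitely a \<in> M"
    then obtain r where r: "r \<in> strict_for D X" "\<forall>a\<in>ante r. ADefinitely a \<in> M" by blast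
    then show ?l
      using set_enum[of r] rules_forD(2)[OF r(1)]
      by (intro in_M_intro[OF definitely_strict[of "label r" D X "enum r"]])
        (auto simp: AStrict_iff)
  qed
qed

lemma ADefeated_iff:
  assumes s: "s \<in> rules D"
  shows "ADefeated (label s) (compl X) \<in> M \<longleftrightarrow>
     (\<exists>t\<in>supportive_for D X. (t, s) \<in> superior D \<and> (\<forall>a\<in>ante t. ADefeasibly a \<in> M))"
    (is "?l \<longleftrightarrow> ?r")
proof
  assume ?l
  then have "\<exists>T Vs. ASup T (label s) \<in> M \<and> ASupportiveRule T X Vs \<in> M \<and> ADefeasibly ` set Vs \<subseteq> M"
  proof (rule in_M_cases)
    fix ps ns assume "Clause (ADefeated (label s) (compl X)) ps ns \<in> Pr" "set ps \<subseteq> M"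
    then show ?thesis
      by (auto elim!: program_headE) blast
  qed
  then obtain T Vs where T: "ASup T (label s) \<in> M" "ASupportiveRule T X Vs \<in> M"
    "ADefeasibly ` set Vs \<subseteq> M" by blast
  \<comment> \<open>\<open>t\<close> comes from the rule atom and \<open>t'\<close> from the
    superiority atom; they share the label \<open>T\<close> and hence coincide.\<close>
  then obtain t t' s' where t: "t \<in> supportive_for D X" "T = label t" "Vs = enum t"
    "(t', s') \<in> superior D" "T = label t'" "label s = label s'"
    unfolding ASup_iff ASupportiveRule_iff by blast
  then have "t' = t" "s' = s"
    using label_eq superior_rules rules_forD s by metis+
  then show ?r
    using t T set_enum[OF rules_forD(3)[OF t(1)]] by auto
next
  assume ?r
  then obtain t where t: "t \<in> supportive_for D X" "(t, s) \<in> superior D"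
    "\<forall>a\<in>ante t. ADefeasibly a \<in> M" by blast
  then show ?l
    using s set_enum[of t] rules_forD(3)[OF t(1)]
    by (intro in_M_intro[OF defeated[of "label s" D "label t" X "enum t"]])
      (auto simp: ASup_iff ASupportiveRule_iff)
qed

text \<open>Being overruled depends on the attackers of \<open>X\<close> alone;
  \<open>r \<in> rules D\<close> makes \<open>label r\<close> a legal instance of the label
  variable.\<close>

lemma AOverruled_iff:
  assumes r: "r \<in> rules D"
  shows "AOverruled (label r) X \<in> M \<longleftrightarrow>
     (\<exists>s\<in>rules_for D (compl X). (\<forall>a\<in>ante s. ADefeasibly a \<in> M) \<and>
        \<not> (\<exists>t\<in>supportive_for D X. (t, s) \<in> superior D \<and> (\<forall>a\<in>ante t. ADefeasibly a \<in> M)))"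
    (is "?l \<longleftrightarrow> ?r")
proof
  assume ?l
  then have "\<exists>S Us. ARule S (compl X) Us \<in> M \<and> ADefeasibly ` set Us \<subseteq> M \<and>
      ADefeated S (compl X) \<notin> M"
    by (auto elim!: in_M_cases[of "AOverruled (label r) X"] program_headE) blast
  then obtain s where s: "s \<in> rules_for D (compl X)" "ADefeasibly ` set (enum s) \<subseteq> M"
    "ADefeated (label s) (compl X) \<notin> M"
    unfolding ARule_iff by blast
  then show ?r
    using set_enum[OF rules_forD(1)[OF s(1)]] unfolding ADefeated_iff[OF rules_forD(1)[OF s(1)]]
    by blast
next
  assume ?r
  then obtain s where s: "s \<in> rules_for D (compl X)" "\<forall>a\<in>ante s. ADefeasibly a \<in> M"
    "ADefeated (label s) (compl X) \<notin> M"
    using ADefeated_iff rules_forD(1) by blast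
  then show ?l
    using r set_enum[of s] rules_forD(1)[OF s(1)]
    by (intro in_M_intro[OF overruled[of "label r" D "label s" X "enum s"]])
      (auto simp: ARule_iff)
qed

text \<open>Combined with \<open>AOverruled_iff\<close> this mirrors the \<open>PlusPartial\<close>
  condition, default negation playing the role of minus tags.\<close>

lemma ADefeasibly_iff:
  "ADefeasibly X \<in> M \<longleftrightarrow> ADefinitely X \<in> M \<or>
     (ADefinitely (compl X) \<notin> M \<and>
      (\<exists>r\<in>supportive_for D X. (\<forall>a\<in>ante r. ADefeasibly a \<in> M) \<and> AOverruled (label r) X \<notin> M))"
    (is "?l \<longleftrightarrow> ?r")
proof
  assume ?l
  then have "ADefinitely X \<in> M \<or> (ADefinitely (compl X) \<notin> M \<and>
      (\<exists>R Ys. ASupportiveRule R X Ys \<in> M \<and> ADefeasibly ` set Ys \<subseteq> M \<and> AOverruled R X \<notin> M))"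
    by (auto elim!: in_M_cases[of "ADefeasibly X"] program_headE) blast
  then show ?r
  proof (elim disjE conjE exE)
    fix R Ys
    assume *: "ADefinitely (compl X) \<notin> M" "ASupportiveRule R X Ys \<in> M"
      "ADefeasibly ` set Ys \<subseteq> M" "AOverruled R X \<notin> M"
    then obtain r where r: "r \<in> supportive_for D X" "R = label r" "Ys = enum r"
      unfolding ASupportiveRule_iff by blast
    then show ?r using * set_enum[OF rules_forD(3)[OF r(1)]] by (auto simp: image_subset_iff)
  qed simp
next
  assume ?r
  then show ?l
  proof
    assume "ADefinitely X \<in> M"
    then show ?l using in_M_intro[OF defeasibly_definitely] by simp
  next
    assume "ADefinitely (compl X) \<notin> M \<and>
      (\<exists>r\<in>supportive_for D X. (\<forall>a\<in>ante r. ADefeasibly a \<in> M) \<and> AOverruled (label r) X \<notin> M)"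
    then obtain r where r: "r \<in> supportive_for D X" "\<forall>a\<in>ante r. ADefeasibly a \<in> M"
      "AOverruled (label r) X \<notin> M" "ADefinitely (compl X) \<notin> M" by blast
    then show ?l
      using set_enum[of r] rules_forD(3)[OF r(1)]
      by (intro in_M_intro[OF defeasibly_supportive[of "label r" D X "enum r"]])
        (auto simp: ASupportiveRule_iff)
  qed
qed

section \<open>Soundness\<close>

primrec models :: "'a tagged \<Rightarrow> bool" where
  "models (PlusDelta q) \<longleftrightarrow> ADefinitely q \<in> M"
| "models (MinusDelta q) \<longleftrightarrow> ADefinitely q \<notin> M"
| "models (PlusPartial q) \<longleftrightarrow> ADefeasibly q \<in> M"
| "models (MinusPartial q) \<longleftrightarrow> ADefeasibly q \<notin> M"

text \<open>With minus tags read as absence from \<open>M\<close>, the plus conditions become the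
  right-hand sides of the completion equivalences and the minus conditions their negations.\<close>

lemma step_ok_models:
  assumes "step_ok D {K. models K} L"
  shows "models L"
proof (cases L)
  case (PlusDelta q)
  with assms show ?thesis by (simp add: ADefinitely_iff[of q])
next
  case (MinusDelta q)
  with assms show ?thesis by (simp add: ADefinitely_iff[of q])
next
  case (PlusPartial q)
  with assms show ?thesis
    using AOverruled_iff[OF rules_forD(3), of _ q q] by (simp add: ADefeasibly_iff[of q]) blast
next
  case (MinusPartial q)
  with assms show ?thesis
    using AOverruled_iff[OF rules_forD(3), of _ q q] by (simp add: ADefeasibly_iff[of q]) blast
qed

lemma derivable_models: "derivable D L \<Longrightarrow> models L"
  using derivable_induct[of D models] step_ok_models by blast

end

section \<open>The canonical stable model of a decisive theory\<close>

context theory_program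
begin

definition applicable :: "('l, 'a) drule \<Rightarrow> bool" where
  "applicable r \<longleftrightarrow> (\<forall>a\<in>ante r. derivable D (PlusPartial a))"

text \<open>\<open>AOverruled\<close> admits every label and \<open>ADefeated\<close> every inferior
  rule, whatever its head, because the program clauses do not tie these labels to the literal.
  Failure is plain non-derivability here.\<close>

primrec canonical :: "('l, 'a) gatom \<Rightarrow> bool" where
  "canonical (AFact q) \<longleftrightarrow> q \<in> facts D"
| "canonical (AStrict R X B) \<longleftrightarrow> (\<exists>r\<in>strict_for D X. R = label r \<and> B = enum r)"
| "canonical (ADefeasible R X B) \<longleftrightarrow>
     (\<exists>r\<in>rules_for D X. kind r = Defeasible \<and> R = label r \<and> B = enum r)"
| "canonical (ADefeater R X B) \<longleftrightarrow>
     (\<exists>r\<in>rules_for D X. kind r = Defeater \<and> R = label r \<and> B = enum r)"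
| "canonical (ASup T S) \<longleftrightarrow> (\<exists>t s. (t, s) \<in> superior D \<and> T = label t \<and> S = label s)"
| "canonical (ASupportiveRule R X B) \<longleftrightarrow> (\<exists>r\<in>supportive_for D X. R = label r \<and> B = enum r)"
| "canonical (ARule R X B) \<longleftrightarrow> (\<exists>r\<in>rules_for D X. R = label r \<and> B = enum r)"
| "canonical (ADefinitely q) \<longleftrightarrow> derivable D (PlusDelta q)"
| "canonical (ADefeasibly q) \<longleftrightarrow> derivable D (PlusPartial q)"
| "canonical (AOverruled R X) \<longleftrightarrow> R \<in> label ` rules D \<and>
     (\<exists>s\<in>rules_for D (compl X). applicable s \<and>
        \<not> (\<exists>t\<in>supportive_for D X. (t, s) \<in> superior D \<and> applicable t))"
| "canonical (ADefeated S Y) \<longleftrightarrow>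
     (\<exists>s t. S = label s \<and> t \<in> supportive_for D (compl Y) \<and> (t, s) \<in> superior D \<and> applicable t)"

lemma canonical_ADefeated:
  assumes "s \<in> rules D"
  shows "canonical (ADefeated (label s) Y) \<longleftrightarrow>
     (\<exists>t\<in>supportive_for D (compl Y). (t, s) \<in> superior D \<and> applicable t)"
  using assms label_eq superior_rules by fastforce

lemma applicable_enum:
  "r \<in> rules D \<Longrightarrow> applicable r \<longleftrightarrow> ADefeasibly ` set (enum r) \<subseteq> {h. canonical h}"
  by (auto simp: applicable_def set_enum)

text \<open>Default negation yields only non-derivability, while \<open>PlusPartial\<close> demands
  derivable minus tags; decidedness bridges the gap.\<close>

lemma canonical_defeasibly_supportive:
  assumes dec: "decisive D" and r: "r \<in> supportive_for D X" "applicable r"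
    and neg: "\<not> canonical (ADefinitely (compl X))" "\<not> canonical (AOverruled (label r) X)"
  shows "derivable D (PlusPartial X)"
proof (rule derivable_step[OF D])
  have "derivable D (MinusDelta (compl X))"
    using neg(1) decisive_decided[OF D dec, of "compl X"] by (simp add: decided_def)
  moreover have "(\<exists>a\<in>ante s. derivable D (MinusPartial a)) \<or>
      (\<exists>t\<in>supportive_for D X. (t, s) \<in> superior D \<and> applicable t)"
    if "s \<in> rules_for D (compl X)" for s
  proof (cases "applicable s")
    case True
    then show ?thesis using neg(2) that rules_forD(3)[OF r(1)] by auto
  next
    case False
    then show ?thesis
      using decisive_decided[OF D dec] by (auto simp: applicable_def decided_def)
  qed
  ultimately show "step_ok D {K. derivable D K} (PlusPartial X)"
    using r by (auto simp: applicable_def)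
qed

text \<open>Checked clause by clause; decisiveness enters only at
  \<open>defeasibly_supportive\<close>.\<close>

lemma canonical_model:
  assumes dec: "decisive D"
  shows "herbrand_model (reduct Pr {h. canonical h}) {h. canonical h}"
  unfolding herbrand_model_reduct
proof (intro ballI impI)
  fix c assume "c \<in> Pr" and neg: "set (cneg c) \<inter> {h. canonical h} = {}"
    and pos: "set (cpos c) \<subseteq> {h. canonical h}"
  then show "chead c \<in> {h. canonical h}"
  proof cases
    case (definitely_fact X)
    then show ?thesis using pos derivable_step[OF D, of "PlusDelta X"] by simp
  next
    case (definitely_strict R X Ys)
    then obtain r where r: "r \<in> strict_for D X" "Ys = enum r" using pos by auto
    then have "\<forall>a\<in>ante r. derivable D (PlusDelta a)"
      using pos definitely_strict set_enum[OF rules_forD(2)[OF r(1)]] by auto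
    then show ?thesis
      using r definitely_strict derivable_step[OF D, of "PlusDelta X"] by auto
  next
    case (defeasibly_definitely X)
    then show ?thesis using pos derivable_step[OF D, of "PlusPartial X"] by simp
  next
    case (defeasibly_supportive R X Ys)
    then obtain r where r: "r \<in> supportive_for D X" "R = label r" "Ys = enum r"
      using pos by auto
    then have "applicable r"
      using pos defeasibly_supportive applicable_enum[OF rules_forD(3)[OF r(1)]] by auto
    then show ?thesis
      using canonical_defeasibly_supportive[OF dec r(1)] neg r defeasibly_supportive
      by simp
  next
    case (overruled R S X Us)
    then obtain s where s: "s \<in> rules_for D (compl X)" "S = label s" "Us = enum s"
      using pos by auto
    then have "applicable s"
      using pos overruled applicable_enum[OF rules_forD(1)[OF s(1)]] by auto
    moreover have "\<not> canonical (ADefeated (label s) (compl X))"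
      using neg s overruled by (simp del: canonical.simps)
    ultimately show ?thesis
      using s overruled canonical_ADefeated[OF rules_forD(1)[OF s(1)], of "compl X"] by auto
  next
    case (defeated S T X Vs)
    then obtain t t' s where t: "t \<in> supportive_for D X" "T = label t" "Vs = enum t"
      "(t', s) \<in> superior D" "T = label t'" "S = label s"
      using pos by auto
    then have "t' = t" using label_eq superior_rules rules_forD(3) by metis
    moreover have "applicable t"
      using t pos defeated applicable_enum[OF rules_forD(3)[OF t(1)]] by auto
    ultimately show ?thesis using t defeated by auto
  qed (use pos in \<open>auto simp: strict_for_def supportive_for_def rules_for_def\<close>)
qed

text \<open>Each plus step of a derivation is simulated by a clause that survives in the reduct;
  coherence ensures the survival.\<close>

lemma canonical_least:
  assumes N: "herbrand_model (reduct Pr {h. canonical h}) N"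
  shows "{h. canonical h} \<subseteq> N"
proof -
  \<comment> \<open>Positive bodies are tested in \<open>N\<close>, but negative ones in the
    canonical set, which defines the reduct.\<close>
  have N_intro: "h \<in> N"
    if "Clause h ps ns \<in> Pr" "set ps \<subseteq> N" "\<forall>n\<in>set ns. \<not> canonical n" for h ps ns
    using N that unfolding herbrand_model_reduct by fastforce
  have base: "AFact q \<in> N" if "q \<in> facts D" for q
    using that by (auto intro: N_intro fact)
  have strict: "AStrict (label r) X (enum r) \<in> N" if "r \<in> strict_for D X" for r X
    using that by (auto simp: strict_for_def rules_for_def intro: N_intro program.strict)
  have defeasible: "ADefeasible (label r) X (enum r) \<in> N"
    if "r \<in> rules_for D X" "kind r = Defeasible" for r X
    using that by (auto simp: rules_for_def intro: N_intro program.defeasible)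
  have defeater: "ADefeater (label r) X (enum r) \<in> N"
    if "r \<in> rules_for D X" "kind r = Defeater" for r X
    using that by (auto simp: rules_for_def intro: N_intro program.defeater)
  have sup: "ASup (label t) (label s) \<in> N" if "(t, s) \<in> superior D" for t s
    using that by (auto intro: N_intro program.sup)
  have supportive: "ASupportiveRule (label r) X (enum r) \<in> N" if r: "r \<in> supportive_for D X" for r X
  proof (cases "kind r = Strict")
    case True
    then have "r \<in> strict_for D X" using r by (auto simp: strict_for_def supportive_for_def)
    then show ?thesis
      using r strict by (intro N_intro[OF supportive_strict]) (auto dest: rules_forD)
  next
    case False
    then have "r \<in> rules_for D X" "kind r = Defeasible" using r by (auto simp: supportive_for_def)
    then show ?thesis
      using defeasible by (intro N_intro[OF supportive_defeasible]) (auto dest: rules_forD)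
  qed
  have rule: "ARule (label r) X (enum r) \<in> N" if r: "r \<in> rules_for D X" for r X
  proof (cases "kind r = Defeater")
    case True
    then show ?thesis
      using r defeater by (intro N_intro[OF rule_defeater]) (auto dest: rules_forD)
  next
    case False
    then have "r \<in> supportive_for D X"
      using r by (cases "kind r") (auto simp: supportive_for_def)
    then show ?thesis
      using supportive by (intro N_intro[OF rule_supportive]) (auto dest: rules_forD)
  qed
  have coh: "\<not> (derivable D (PlusDelta q) \<and> derivable D (MinusDelta q))"
      "\<not> (derivable D (PlusPartial q) \<and> derivable D (MinusPartial q))" for q
    using derivable_coherent[of D] by (auto simp: coherent_def)
  \<comment> \<open>\<open>Q\<close> also records derivability, so that coherence applies to the negative tags: it shows that
    the negated body atoms of the clauses used are not canonical.\<close>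
  define Q where "Q L = (derivable D L \<and> (case L of
      PlusDelta q \<Rightarrow> ADefinitely q \<in> N | PlusPartial q \<Rightarrow> ADefeasibly q \<in> N | _ \<Rightarrow> True))" for L
  have Q: "Q L" if L: "derivable D L" for L
  proof (rule derivable_induct[OF _ L])
    fix L assume step: "step_ok D {K. Q K} L"
    have dL: "derivable D L"
      using step by (rule derivable_step[OF D step_ok_mono]) (auto simp: Q_def)
    show "Q L"
    proof (cases L)
      case (PlusDelta q)
      have "ADefinitely q \<in> N"
      proof (cases "q \<in> facts D")
        case True
        then show ?thesis using base by (intro N_intro[OF definitely_fact]) auto
      next
        case False
        then obtain r where r: "r \<in> strict_for D q" "\<forall>a\<in>ante r. ADefinitely a \<in> N"
          using step PlusDelta by (auto simp: Q_def)
        then show ?thesis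
          using strict set_enum[of r] rules_forD(2)[OF r(1)]
          by (intro N_intro[OF definitely_strict[of "label r" D q "enum r"]]) auto
      qed
      then show ?thesis using dL PlusDelta by (simp add: Q_def)
    next
      case (PlusPartial q)
      have "ADefeasibly q \<in> N"
      proof (cases "Q (PlusDelta q)")
        case True
        then show ?thesis by (intro N_intro[OF defeasibly_definitely]) (auto simp: Q_def)
      next
        case False
        then obtain r where r: "r \<in> supportive_for D q" "\<forall>a\<in>ante r. ADefeasibly a \<in> N"
          and cq: "derivable D (MinusDelta (compl q))"
          and s: "\<forall>s\<in>rules_for D (compl q). (\<exists>a\<in>ante s. derivable D (MinusPartial a)) \<or>
            (\<exists>t\<in>supportive_for D q. (t, s) \<in> superior D \<and> applicable t)"
          using step PlusPartial by (auto simp: Q_def applicable_def) blast+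
        \<comment> \<open>By coherence an attacker with a derivably failed antecedent is not
          applicable; every other attacker is beaten.\<close>
        have "\<not> canonical (AOverruled (label r) q)"
          using s coh(2) by (auto simp: applicable_def) blast
        moreover have "\<not> canonical (ADefinitely (compl q))"
          using cq coh(1) by auto
        ultimately show ?thesis
          using r supportive set_enum[of r] rules_forD(3)[OF r(1)]
          by (intro N_intro[OF defeasibly_supportive[of "label r" D q "enum r"]])
            (auto simp del: canonical.simps)
      qed
      then show ?thesis using dL PlusPartial by (simp add: Q_def)
    qed (use dL in \<open>simp_all add: Q_def\<close>)
  qed
  \<comment> \<open>Overruled and defeated atoms occur in bodies only under negation, so in the
    reduct they feed no other clause and can be treated after the induction.\<close>
  have app: "ADefeasibly ` set (enum r) \<subseteq> N" if "r \<in> rules D" "applicable r" for r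
    using that Q[of "PlusPartial _"] by (auto simp: applicable_def set_enum Q_def)
  have "h \<in> N" if h: "canonical h" for h
  proof (cases h)
    case (ADefinitely q)
    then show ?thesis using h Q[of "PlusDelta q"] by (simp add: Q_def)
  next
    case (ADefeasibly q)
    then show ?thesis using h Q[of "PlusPartial q"] by (simp add: Q_def)
  next
    case (AOverruled R X)
    with h obtain s where R: "R \<in> label ` rules D"
      and s: "s \<in> rules_for D (compl X)" "applicable s"
      and not_defeated: "\<not> (\<exists>t\<in>supportive_for D X. (t, s) \<in> superior D \<and> applicable t)"
      by auto
    have "\<not> canonical (ADefeated (label s) (compl X))"
      using not_defeated canonical_ADefeated[OF rules_forD(1)[OF s(1)], of "compl X"] by simp
    then show ?thesis
      unfolding AOverruled
      using R s rule app rules_forD(1)[OF s(1)]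
      by (intro N_intro[OF overruled[of R D "label s" X "enum s"]]) (auto simp del: canonical.simps)
  next
    case (ADefeated S Y)
    with h obtain s t where t: "S = label s" "t \<in> supportive_for D (compl Y)"
      "(t, s) \<in> superior D" "applicable t" by auto
    then show ?thesis
      unfolding ADefeated
      using N_intro[OF defeated[of S D "label t" "compl Y" "enum t"]] sup supportive app
        superior_rules[OF t(3)] by auto
  qed (use h base strict defeasible defeater sup supportive rule in auto)
  then show ?thesis by blast
qed

lemma canonical_stable: "decisive D \<Longrightarrow> stable_model Pr {h. canonical h}"
  using canonical_model canonical_least by (simp add: stable_model_def least_herbrand_model_def)

text \<open>Frees \<open>M\<close> from the locale, so that soundness also applies to the canonical
  model.\<close>

lemma derivable_sound:
  assumes "stable_model Pr M"
  shows "derivable D (PlusPartial q) \<Longrightarrow> ADefeasibly q \<in> M"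
    and "derivable D (MinusPartial q) \<Longrightarrow> ADefeasibly q \<notin> M"
proof -
  interpret theory_stable_model D enum M by unfold_locales (rule assms)
  show "derivable D (PlusPartial q) \<Longrightarrow> ADefeasibly q \<in> M"
    and "derivable D (MinusPartial q) \<Longrightarrow> ADefeasibly q \<notin> M"
    using derivable_models by force+
qed

end

theorem theorem5p3:
  fixes D :: "('l, 'a) dtheory"
    and enum :: "('l, 'a) drule \<Rightarrow> 'a literal list"
    and p :: "'a literal"
  assumes "defeasible_theory D"
    and "antecedent_enum D enum"
  shows "(derivable D (PlusPartial p) \<longrightarrow>
            (\<forall>M. stable_model (program D enum) M \<longrightarrow> ADefeasibly p \<in> M)) \<and>
         (derivable D (MinusPartial p) \<longrightarrow>
            (\<forall>M. stable_model (program D enum) M \<longrightarrow> ADefeasibly p \<notin> M)) \<and>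
         (decisive D \<longrightarrow>
            ((\<forall>M. stable_model (program D enum) M \<longrightarrow> ADefeasibly p \<in> M) \<longrightarrow>
               derivable D (PlusPartial p)) \<and>
            ((\<forall>M. stable_model (program D enum) M \<longrightarrow> ADefeasibly p \<notin> M) \<longrightarrow>
               derivable D (MinusPartial p)))"
proof -
  interpret theory_program D enum by unfold_locales (use assms in auto)
  have "derivable D (PlusPartial p) \<or> derivable D (MinusPartial p)" if "decisive D"
    using decisive_decided[OF D that] by (simp add: decided_def)
  then show ?thesis
    using derivable_sound canonical_stable by blast
qed

end
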